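(* Let $0<\theta<\pi$, and let $\Delta=\{z\in\mathbb{C}:|z|<1\}$. For $\zeta$ near $-1$ define \[ f(z)=\int_{-1}^{z}\frac{(\zeta+1)^{1-\theta/\pi}\left(\zeta^{2}-2\,\tfrac{\pi-\theta}{\pi+\theta}\,\zeta+1\right)^{(\pi+\theta)/(2\pi)}}{\zeta^{2}}\,d\zeta , \] the integral taken along a path in $\Delta$, with principal branches of all powers. Define \[ \xi(z)=\frac{(\sqrt{\pi}-i\sqrt{\theta})(z+1)}{2\sqrt{\pi}},\qquad \eta(z)=\frac{(\sqrt{\pi}+i\sqrt{\theta})(z+1)}{2\sqrt{\pi}}, \] \[ \varphi(z)=\left[\frac{\pi(z-1)^{2}+\theta(z+1)^{2}}{\pi+\theta}\right]^{(\pi+\theta)/(2\pi)},\qquad \psi(z)=\left[\frac{\pi(z-1)^{2}+\theta(z+1)^{2}}{\pi+\theta}\right]^{(\pi-\theta)/(2\pi)}, \] \[ \delta(z)=\left[-\sqrt{\pi}(z-1)-i\sqrt{\theta}(z+1)\right]^{(\pi-\theta)/(2\pi)}\left[-\sqrt{\pi}(z-1)+i\sqrt{\theta}(z+1)\right]^{(\pi-\theta)/(2\pi)}, \] again with principal branches. Then for all $z\in\Delta$ with $|z+1|$ sufficiently small, \begin{align*} f(z)=(z+1)^{1-\theta/\pi}\Bigg\{&-\frac{\varphi(z)}{z}+\frac{2^{\theta/\pi}\pi^{(\pi+\theta)/(2\pi)}}{2\pi^{2}+\pi\theta-\theta^{2}}\,\frac{\delta(z)}{\psi(z)}\Bigg[-2(2\pi-\theta)\,F_{1}\!\left(1-\tfrac{\theta}{\pi},\tfrac{\pi-\theta}{2\pi},\tfrac{\pi-\theta}{2\pi},2-\tfrac{\theta}{\pi};\xi(z),\eta(z)\right)\\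 &+(\pi+\theta)(z+1)\,F_{1}\!\left(2-\tfrac{\theta}{\pi},\tfrac{\pi-\theta}{2\pi},\tfrac{\pi-\theta}{2\pi},3-\tfrac{\theta}{\pi};\eta(z),\xi(z)\right)\Bigg]\Bigg\}. \end{align*}
   Context: $F_1$ denotes the Appell hypergeometric function \[ F_{1}(a,b,b',c;x,y)=\sum_{m=0}^{\infty}\sum_{n=0}^{\infty}\frac{(a)_{m+n}(b)_m(b')_n}{(c)_{m+n}\,m!\,n!}x^{m}y^{n},\qquad |x|<1,\ |y|<1, \] where $(s)_k=\Gamma(s+k)/\Gamma(s)$ is the Pochhammer symbol. Principal branches of complex powers are used throughout (all bases involved are positive real at $z=-1$). *)

theory Defs
  imports "HOL-Analysis.Analysis"
begin

text \<open>Appell hypergeometric function F1 as the double power series.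
  Complex powers below are Isabelle's complex powr, i.e. principal branch
  (z powr a = exp (a * Ln z) for z \<noteq> 0).\<close>
definition appell_F1 ::
  "complex \<Rightarrow> complex \<Rightarrow> complex \<Rightarrow> complex \<Rightarrow> complex \<Rightarrow> complex \<Rightarrow> complex" where
  "appell_F1 a b b' c x y =
     (\<Sum>m. \<Sum>n. pochhammer a (m + n) * pochhammer b m * pochhammer b' n
               / (pochhammer c (m + n) * fact m * fact n) * x ^ m * y ^ n)"

definition integrand :: "real \<Rightarrow> complex \<Rightarrow> complex" where
  "integrand \<theta> \<zeta> =
     (\<zeta> + 1) powr (of_real (1 - \<theta> / pi))
     * (\<zeta>\<^sup>2 - 2 * of_real ((pi - \<theta>) / (pi + \<theta>)) * \<zeta> + 1)
         powr (of_real ((pi + \<theta>) / (2 * pi)))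
     / \<zeta>\<^sup>2"

text \<open>f(z) = integral of the integrand from -1 to z along the straight segment
  [-1, z] (a path in the unit disc near -1), parametrised by
  \<zeta> = -1 + t (z + 1), t \<in> [0,1].\<close>
definition f_int :: "real \<Rightarrow> complex \<Rightarrow> complex" where
  "f_int \<theta> z = integral {0..1::real} (\<lambda>t. integrand \<theta> (-1 + of_real t * (z + 1)) * (z + 1))"

definition xi_fn :: "real \<Rightarrow> complex \<Rightarrow> complex" where
  "xi_fn \<theta> z = (of_real (sqrt pi) - \<i> * of_real (sqrt \<theta>)) * (z + 1) / (2 * of_real (sqrt pi))"

definition eta_fn :: "real \<Rightarrow> complex \<Rightarrow> complex" where
  "eta_fn \<theta> z = (of_real (sqrt pi) + \<i> * of_real (sqrt \<theta>)) * (z + 1) / (2 * of_real (sqrt pi))"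

definition phi_fn :: "real \<Rightarrow> complex \<Rightarrow> complex" where
  "phi_fn \<theta> z = ((of_real pi * (z - 1)\<^sup>2 + of_real \<theta> * (z + 1)\<^sup>2) / of_real (pi + \<theta>))
                    powr (of_real ((pi + \<theta>) / (2 * pi)))"

definition psi_fn :: "real \<Rightarrow> complex \<Rightarrow> complex" where
  "psi_fn \<theta> z = ((of_real pi * (z - 1)\<^sup>2 + of_real \<theta> * (z + 1)\<^sup>2) / of_real (pi + \<theta>))
                    powr (of_real ((pi - \<theta>) / (2 * pi)))"

definition delta_fn :: "real \<Rightarrow> complex \<Rightarrow> complex" where
  "delta_fn \<theta> z =
     (- of_real (sqrt pi) * (z - 1) - \<i> * of_real (sqrt \<theta>) * (z + 1)) powr (of_real ((pi - \<theta>) / (2 * pi)))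
   * (- of_real (sqrt pi) * (z - 1) + \<i> * of_real (sqrt \<theta>) * (z + 1)) powr (of_real ((pi - \<theta>) / (2 * pi)))"

end

theory Submission
  imports Defs
begin

text \<open>
  Write \<open>w = z + 1\<close>, \<open>a = 1 - \<theta>/\<pi>\<close>, \<open>e = (\<pi> - \<theta>)/(2\<pi>)\<close> and \<open>b = (\<pi> + \<theta>)/(2\<pi>) = 1 - e\<close>.
  Along the segment \<open>\<zeta> = -1 + t w\<close> the integrand of \<open>f\<close> equals \<open>(t w)^a R(t w) w\<close> with
  \<open>R(u) = Q(u)^b / (u - 1)^2\<close>, where \<open>Q(u) = (\<pi>(u - 2)^2 + \<theta> u^2)/(\<pi> + \<theta>)\<close> is the quadratic
  of the integrand written in \<open>u = \<zeta> + 1\<close>.  The proof rests on one observation: if \<open>B\<close> solves the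
  Euler-type equation \<open>a B(u) + u B'(u) = u R(u)\<close> near \<open>0\<close>, then \<open>(t w)^a B(t w)\<close> is a primitive of
  the integrand in \<open>t\<close>, so \<open>f(z) = w^a B(w)\<close>.

  The Appell function with \<open>b = b' = e\<close> and \<open>c = a + 1\<close> solves an equation of this type: summing
  its series along diagonals gives \<open>F1(a, e, e, a + 1; x u, y u) = \<Sum> a/(a + n) D_n u^n\<close>, where
  \<open>\<Sum> D_n u^n\<close> is the Cauchy product of the binomial series of \<open>(1 - x u)^-e\<close> and \<open>(1 - y u)^-e\<close>;
  hence \<open>a F + u F' = a (1 - x u)^-e (1 - y u)^-e\<close>.  Since \<open>Q(u)\<close> is a constant times
  \<open>(1 - \<lambda>1 u)(1 - \<lambda>2 u)\<close>, where \<open>\<xi> = \<lambda>1 w\<close> and \<open>\<eta> = \<lambda>2 w\<close>, the bracket \<open>B(w)\<close> of the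
  theorem is \<open>-Q(w)^b/(w - 1)\<close> plus a combination of two such Appell functions, and a polynomial
  identity for \<open>Q\<close> shows that \<open>B\<close> solves the required Euler equation.
\<close>

text \<open>Principal powers are multiplicative on the right half-plane, where the arguments add without wrapping.\<close>
lemma powr_mult_Re_pos:
  fixes x y a :: complex
  assumes "0 < Re x" "0 < Re y"
  shows "(x * y) powr a = x powr a * y powr a"
proof -
  have nz: "x \<noteq> 0" "y \<noteq> 0" using assms by auto
  have "\<bar>Im (Ln x)\<bar> < pi/2" "\<bar>Im (Ln y)\<bar> < pi/2" using assms Re_Ln_pos_lt_imp by auto
  then have "Ln (x * y) = Ln x + Ln y" using nz by (intro Ln_times_simple) auto
  then show ?thesis using nz by (simp add: powr_def exp_add distrib_left)
qed

section \<open>Binomial series and their products\<close>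

text \<open>The coefficients \<open>(e)_m / m!\<close> of the binomial series of \<open>(1 - x)^-e\<close>.\<close>
definition neg_binom :: "real \<Rightarrow> nat \<Rightarrow> real" where
  "neg_binom e m = pochhammer e m / fact m"

text \<open>For \<open>0 \<le> e \<le> 1\<close> these coefficients lie in \<open>[0, 1]\<close>; this gives all convergence estimates.\<close>
lemma neg_binom_bounds:
  assumes "0 \<le> e" "e \<le> 1"
  shows "0 \<le> neg_binom e m \<and> neg_binom e m \<le> 1"
proof (induction m)
  case 0 then show ?case by (simp add: neg_binom_def)
next
  case (Suc m)
  have step: "neg_binom e (Suc m) = neg_binom e m * ((e + m) / (m + 1))"
    by (simp add: neg_binom_def pochhammer_rec' field_simps)
  have factor: "0 \<le> (e + m) / (m + 1)" "(e + m) / (m + 1) \<le> 1" using assms by auto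
  show ?case unfolding step using Suc factor by (simp only: mult_nonneg_nonneg mult_le_one)
qed

lemma norm_neg_binom_term:
  fixes x :: complex
  assumes "0 \<le> e" "e \<le> 1" "norm x \<le> r"
  shows "norm (of_real (neg_binom e i) * x ^ i) \<le> r ^ i"
proof -
  have "norm (of_real (neg_binom e i) * x ^ i) = \<bar>neg_binom e i\<bar> * norm x ^ i"
    by (simp add: norm_mult norm_power)
  also have "\<dots> \<le> 1 * r ^ i"
    using neg_binom_bounds[OF assms(1,2), of i] assms(3) by (intro mult_mono power_mono) auto
  finally show ?thesis by simp
qed

lemma neg_binom_sums:
  fixes x :: complex
  assumes "norm x < 1"
  shows "(\<lambda>n. of_real (neg_binom e n) * x ^ n) sums ((1 - x) powr (- of_real e))"
proof -
  have "(\<lambda>n. ((- of_real e) gchoose n) * (- x) ^ n) sums ((1 + - x) powr (- of_real e))"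
    by (rule gen_binomial_complex) (use assms in auto)
  moreover have "((- of_real e) gchoose n) * (- x) ^ n = of_real (neg_binom e n) * x ^ n" for n
  proof -
    have "((- of_real e) gchoose n) * (- x) ^ n
          = ((-1) ^ n * (-1) ^ n) * (pochhammer (of_real e) n / fact n) * x ^ n"
      by (simp add: gbinomial_pochhammer power_minus[of x])
    also have "(-1::complex) ^ n * (-1) ^ n = 1" by (simp add: power_mult_distrib[symmetric])
    finally show ?thesis by (simp add: neg_binom_def pochhammer_of_real)
  qed
  ultimately show ?thesis by simp
qed

definition binom_prod :: "real \<Rightarrow> real \<Rightarrow> complex \<Rightarrow> complex \<Rightarrow> nat \<Rightarrow> complex" where
  "binom_prod e e' x y n =
     (\<Sum>i\<le>n. (of_real (neg_binom e i) * x ^ i) * (of_real (neg_binom e' (n - i)) * y ^ (n - i)))"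

lemma binom_prod_sums:
  fixes x y :: complex
  assumes "0 \<le> e" "e \<le> 1" "0 \<le> e'" "e' \<le> 1" "norm x < 1" "norm y < 1"
  shows "binom_prod e e' x y sums ((1 - x) powr (- of_real e) * (1 - y) powr (- of_real e'))"
proof -
  have abs: "summable (\<lambda>k. norm (of_real (neg_binom c k) * z ^ k))"
    if "0 \<le> c" "c \<le> 1" "norm z < 1" for c and z :: complex
    by (rule summable_comparison_test'[where g="\<lambda>k. norm z ^ k"])
       (use that in \<open>auto intro!: norm_neg_binom_term\<close>)
  have "binom_prod e e' x y sums
        ((\<Sum>k. of_real (neg_binom e k) * x ^ k) * (\<Sum>k. of_real (neg_binom e' k) * y ^ k))"
    unfolding binom_prod_def[abs_def]
    by (rule Cauchy_product_sums[OF abs abs]) (use assms in auto)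
  then show ?thesis
    using neg_binom_sums[OF assms(5), of e] neg_binom_sums[OF assms(6), of e'] by (simp add: sums_iff)
qed

lemma binom_prod_scale: "binom_prod e e' (x * u) (y * u) n = binom_prod e e' x y n * u ^ n"
proof -
  have "binom_prod e e' (x * u) (y * u) n
        = (\<Sum>i\<le>n. ((of_real (neg_binom e i) * x ^ i) * (of_real (neg_binom e' (n - i)) * y ^ (n - i)))
                  * (u ^ i * u ^ (n - i)))"
    unfolding binom_prod_def by (intro sum.cong) (auto simp: power_mult_distrib mult_ac)
  also have "\<dots> = (\<Sum>i\<le>n. ((of_real (neg_binom e i) * x ^ i) * (of_real (neg_binom e' (n - i)) * y ^ (n - i)))
                  * u ^ n)"
    by (intro sum.cong) (auto simp: power_add[symmetric])
  finally show ?thesis by (simp add: binom_prod_def sum_distrib_right)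
qed

section \<open>Summation of double series along diagonals\<close>

lemma summable_Suc_pow:
  fixes r :: real
  assumes "0 \<le> r" "r < 1"
  shows "summable (\<lambda>n. real (Suc n) * r ^ n)"
proof -
  have "summable (\<lambda>n. diffs (\<lambda>_. 1::real) n * r ^ n)"
    by (rule termdiff_converges[where K=1]) (use assms in auto)
  then show ?thesis by (simp add: diffs_def)
qed

lemma diagonal_family_summable:
  fixes f :: "nat \<Rightarrow> nat \<Rightarrow> 'a :: banach"
  assumes \<rho>: "0 \<le> \<rho>" "\<rho> < 1" and bound: "\<And>m n. norm (f m n) \<le> \<rho> ^ (m + n)"
  shows "(\<lambda>(k, i). f i (k - i)) summable_on Sigma UNIV (\<lambda>k. {..k})"
proof -
  define g where "g = (\<lambda>(k, i). f i (k - i))"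
  have diag_norm: "summable (\<lambda>k. \<Sum>i\<le>k. norm (g (k, i)))"
  proof (rule summable_comparison_test'[OF summable_Suc_pow[OF \<rho>]])
    fix k
    have "norm (g (k, i)) \<le> \<rho> ^ k" if "i \<le> k" for i
      using bound[of i "k - i"] that by (simp add: g_def)
    then have "(\<Sum>i\<le>k. norm (g (k, i))) \<le> (\<Sum>i\<le>k. \<rho> ^ k)"
      by (intro sum_mono) simp
    then show "norm (\<Sum>i\<le>k. norm (g (k, i))) \<le> real (Suc k) * \<rho> ^ k"
      by (simp add: sum_nonneg)
  qed
  have "(\<lambda>p. norm (g p)) summable_on Sigma UNIV (\<lambda>k. {..k})"
  proof (rule summable_on_SigmaI[where g="\<lambda>k. \<Sum>i\<le>k. norm (g (k, i))"])
    show "((\<lambda>i. norm (g (k, i))) has_sum (\<Sum>i\<le>k. norm (g (k, i)))) {..k}" for k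
      by (rule has_sum_finite) simp
    show "(\<lambda>k. \<Sum>i\<le>k. norm (g (k, i))) summable_on UNIV"
      using diag_norm by (subst summable_on_UNIV_nonneg_real_iff) (auto intro: sum_nonneg)
  qed auto
  then show ?thesis unfolding g_def by (rule abs_summable_summable)
qed

lemma double_series_diagonal:
  fixes f :: "nat \<Rightarrow> nat \<Rightarrow> 'a :: banach"
  assumes \<rho>: "0 \<le> \<rho>" "\<rho> < 1" and bound: "\<And>m n. norm (f m n) \<le> \<rho> ^ (m + n)"
  shows "(\<Sum>m. \<Sum>n. f m n) = (\<Sum>k. \<Sum>i\<le>k. f i (k - i))"
proof -
  obtain S where S: "((\<lambda>(k, i). f i (k - i)) has_sum S) (Sigma UNIV (\<lambda>k. {..k}))"
    using diagonal_family_summable[OF \<rho> bound] summable_on_def by blast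
  have "((\<lambda>k. \<Sum>i\<le>k. f i (k - i)) has_sum S) UNIV"
    by (rule has_sum_SigmaD[OF S]) (auto intro: has_sum_finite)
  then have by_diagonals: "(\<lambda>k. \<Sum>i\<le>k. f i (k - i)) sums S" by (rule has_sum_imp_sums)
  have rows: "((\<lambda>n. f m n) has_sum (\<Sum>n. f m n)) UNIV" for m
  proof -
    have row_norm: "summable (\<lambda>n. norm (f m n))"
    proof (rule summable_comparison_test'[where g="\<lambda>n. \<rho> ^ m * \<rho> ^ n"])
      show "summable (\<lambda>n. \<rho> ^ m * \<rho> ^ n)" using \<rho> by (intro summable_mult summable_geometric) auto
      show "norm (norm (f m n)) \<le> \<rho> ^ m * \<rho> ^ n" for n using bound[of m n] by (simp add: power_add)
    qed
    show ?thesis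
      by (rule norm_summable_imp_has_sum[OF row_norm summable_sums[OF summable_norm_cancel[OF row_norm]]])
  qed
  have bij: "bij_betw (\<lambda>(k, i). (i, k - i)) (Sigma UNIV (\<lambda>k::nat. {..k})) UNIV"
    by (rule bij_betwI[where g="\<lambda>(m, n). (m + n, m)"]) auto
  have "(\<lambda>p. (\<lambda>(m, n). f m n) ((\<lambda>(k, i). (i, k - i)) p)) = (\<lambda>(k, i). f i (k - i))" by auto
  then have "((\<lambda>(m, n). f m n) has_sum S) (Sigma UNIV (\<lambda>_. UNIV))"
    using S has_sum_reindex_bij_betw[OF bij, of "\<lambda>(m, n). f m n" S] by simp
  then have "((\<lambda>m. \<Sum>n. f m n) has_sum S) UNIV"
    by (rule has_sum_SigmaD) (use rows in simp)
  then have by_rows: "(\<lambda>m. \<Sum>n. f m n) sums S" by (rule has_sum_imp_sums)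
  show ?thesis using by_rows by_diagonals by (simp add: sums_iff)
qed

section \<open>The Appell function with \<open>c = a + 1\<close>\<close>

lemma pochhammer_shift_ratio:
  fixes \<alpha> :: real
  assumes "0 < \<alpha>"
  shows "pochhammer (of_real \<alpha>) k / pochhammer (of_real \<alpha> + 1) k = (of_real (\<alpha> / (\<alpha> + k)) :: complex)"
proof -
  have "pochhammer \<alpha> (Suc k) = \<alpha> * pochhammer (\<alpha> + 1) k" by (rule pochhammer_rec)
  moreover have "pochhammer \<alpha> (Suc k) = (\<alpha> + k) * pochhammer \<alpha> k" by (rule pochhammer_rec')
  moreover have "0 < pochhammer (\<alpha> + 1) k" using assms by (intro pochhammer_pos) auto
  moreover have "0 < \<alpha> + k" using assms by simp
  ultimately have "pochhammer \<alpha> k / pochhammer (\<alpha> + 1) k = \<alpha> / (\<alpha> + k)" by (simp add: field_simps)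
  moreover have "(of_real \<alpha> + 1 :: complex) = of_real (\<alpha> + 1)" by simp
  ultimately show ?thesis by (simp only: pochhammer_of_real of_real_divide[symmetric])
qed

text \<open>Summing the Appell series along diagonals \<open>m + n = k\<close>: for \<open>c = a + 1\<close> the coefficient
  depends on \<open>m + n\<close> only, through \<open>\<alpha>/(\<alpha> + k)\<close>, and the rest is the binomial Cauchy product.\<close>
lemma appell_F1_diagonal:
  fixes \<alpha> e e' :: real and x y :: complex
  assumes \<alpha>: "0 < \<alpha>" and e: "0 \<le> e" "e \<le> 1" "0 \<le> e'" "e' \<le> 1" and xy: "norm x < 1" "norm y < 1"
  shows "appell_F1 (of_real \<alpha>) (of_real e) (of_real e') (of_real \<alpha> + 1) x y
         = (\<Sum>n. of_real (\<alpha> / (\<alpha> + n)) * binom_prod e e' x y n)"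
proof -
  define f where "f m n = of_real (\<alpha> / (\<alpha> + real (m + n)))
                    * ((of_real (neg_binom e m) * x ^ m) * (of_real (neg_binom e' n) * y ^ n))" for m n
  have coeff: "pochhammer (of_real \<alpha>) (m + n) * pochhammer (of_real e) m * pochhammer (of_real e') n
               / (pochhammer (of_real \<alpha> + 1) (m + n) * fact m * fact n) * x ^ m * y ^ n = f m n" for m n
  proof -
    have "pochhammer (of_real \<alpha>) (m + n) * pochhammer (of_real e) m * pochhammer (of_real e') n
            / (pochhammer (of_real \<alpha> + 1) (m + n) * fact m * fact n) * x ^ m * y ^ n
          = (pochhammer (of_real \<alpha>) (m + n) / pochhammer (of_real \<alpha> + 1) (m + n))
            * ((pochhammer (of_real e) m / fact m) * x ^ m) * ((pochhammer (of_real e') n / fact n) * y ^ n)"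
      by (simp add: divide_inverse inverse_mult_distrib mult_ac)
    then show ?thesis
      by (simp only: pochhammer_shift_ratio[OF \<alpha>]) (simp add: f_def neg_binom_def pochhammer_of_real mult_ac)
  qed
  define \<rho> where "\<rho> = max (norm x) (norm y)"
  have \<rho>: "0 \<le> \<rho>" "\<rho> < 1" "norm x \<le> \<rho>" "norm y \<le> \<rho>" using xy by (auto simp: \<rho>_def le_max_iff_disj)
  have bound: "norm (f m n) \<le> \<rho> ^ (m + n)" for m n
  proof -
    have "norm (f m n) = \<bar>\<alpha> / (\<alpha> + real (m + n))\<bar>
                         * (norm (of_real (neg_binom e m) * x ^ m) * norm (of_real (neg_binom e' n) * y ^ n))"
      by (simp only: f_def norm_mult norm_of_real)
    also have "\<dots> \<le> 1 * (\<rho> ^ m * \<rho> ^ n)"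
      using \<alpha> \<rho>(1) by (intro mult_mono norm_neg_binom_term e \<rho> mult_nonneg_nonneg) auto
    finally show ?thesis by (simp add: power_add)
  qed
  have "appell_F1 (of_real \<alpha>) (of_real e) (of_real e') (of_real \<alpha> + 1) x y = (\<Sum>m. \<Sum>n. f m n)"
    unfolding appell_F1_def coeff ..
  also have "\<dots> = (\<Sum>k. \<Sum>i\<le>k. f i (k - i))" by (rule double_series_diagonal[OF \<rho>(1,2) bound])
  also have "\<dots> = (\<Sum>n. of_real (\<alpha> / (\<alpha> + n)) * binom_prod e e' x y n)"
    by (simp add: binom_prod_def f_def sum_distrib_left)
  finally show ?thesis .
qed

section \<open>The Euler equation \<open>A B + u B' = v\<close>\<close>

definition euler_eq :: "complex \<Rightarrow> (complex \<Rightarrow> complex) \<Rightarrow> complex \<Rightarrow> complex \<Rightarrow> bool" where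
  "euler_eq A B u v \<longleftrightarrow> (\<exists>B'. (B has_field_derivative B') (at u) \<and> A * B u + u * B' = v)"

lemma euler_eq_add:
  assumes "euler_eq A B u v" "euler_eq A C u w"
  shows "euler_eq A (\<lambda>x. B x + C x) u (v + w)"
proof -
  obtain B' C' where "(B has_field_derivative B') (at u)" "A * B u + u * B' = v"
    and "(C has_field_derivative C') (at u)" "A * C u + u * C' = w"
    using assms unfolding euler_eq_def by blast
  then show ?thesis
    unfolding euler_eq_def by (intro exI[of _ "B' + C'"]) (auto intro: DERIV_add simp: algebra_simps)
qed

lemma euler_eq_cmult:
  assumes "euler_eq A B u v"
  shows "euler_eq A (\<lambda>x. c * B x) u (c * v)"
proof -
  obtain B' where B': "(B has_field_derivative B') (at u)" and "A * B u + u * B' = v"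
    using assms unfolding euler_eq_def by blast
  moreover have "((\<lambda>x. c * B x) has_field_derivative c * B') (at u)" by (rule DERIV_cmult[OF B'])
  ultimately show ?thesis
    unfolding euler_eq_def by (intro exI[of _ "c * B'"]) (auto simp: algebra_simps)
qed

lemma euler_eq_shift:
  assumes "euler_eq (A + 1) B u v"
  shows "euler_eq A (\<lambda>x. x * B x) u (u * v)"
proof -
  obtain B' where B': "(B has_field_derivative B') (at u)" and "(A + 1) * B u + u * B' = v"
    using assms unfolding euler_eq_def by blast
  moreover have "((\<lambda>x. x * B x) has_field_derivative 1 * B u + B' * u) (at u)"
    by (rule DERIV_mult[OF DERIV_ident B'])
  ultimately show ?thesis
    unfolding euler_eq_def by (intro exI[of _ "1 * B u + B' * u"]) (auto simp: algebra_simps)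
qed

lemma euler_eq_transform:
  assumes "euler_eq A B u v" "open S" "u \<in> S" "\<And>x. x \<in> S \<Longrightarrow> B x = C x"
  shows "euler_eq A C u v"
  using assms has_field_derivative_transform_within_open unfolding euler_eq_def by metis

lemma summable_damped_powser:
  fixes d :: "nat \<Rightarrow> complex" and \<alpha> R :: real
  assumes \<alpha>: "0 < \<alpha>" and conv: "\<And>z. norm z < R \<Longrightarrow> summable (\<lambda>n. d n * z ^ n)" and z: "norm z < R"
  shows "summable (\<lambda>n. of_real (\<alpha> / (\<alpha> + n)) * d n * z ^ n)"
proof -
  define r where "r = (norm z + R) / 2"
  have "norm z < r" "r < R" using z by (simp_all add: r_def)
  moreover have "0 < r" unfolding r_def using z norm_ge_zero[of z] by (intro divide_pos_pos) linarith+
  ultimately have "norm z < norm (of_real r :: complex)" "norm (of_real r :: complex) < R" by auto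
  then have abs: "summable (\<lambda>n. norm (d n * z ^ n))" using conv by (intro powser_insidea[of _ "of_real r"]) auto
  have bound: "norm (of_real (\<alpha> / (\<alpha> + n)) * d n * z ^ n) \<le> norm (d n * z ^ n)" for n
  proof -
    have "\<bar>\<alpha> / (\<alpha> + n)\<bar> \<le> 1" using \<alpha> by auto
    then have "\<bar>\<alpha> / (\<alpha> + n)\<bar> * norm (d n * z ^ n) \<le> 1 * norm (d n * z ^ n)"
      by (intro mult_right_mono) auto
    then show ?thesis by (simp only: norm_mult norm_of_real mult.assoc mult_1_left)
  qed
  have "summable (\<lambda>n. norm (of_real (\<alpha> / (\<alpha> + n)) * d n * z ^ n))"
    by (rule summable_comparison_test'[OF abs]) (simp only: real_norm_def abs_norm_cancel bound)
  then show ?thesis by (rule summable_norm_cancel)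
qed

text \<open>The Euler operator acts diagonally on power series: it multiplies the \<open>n\<close>-th coefficient
  by \<open>\<alpha> + n\<close>, so it inverts the damping by \<open>\<alpha>/(\<alpha> + n)\<close>.\<close>
lemma euler_eq_powser:
  fixes d :: "nat \<Rightarrow> complex" and \<alpha> R :: real
  assumes \<alpha>: "0 < \<alpha>" and conv: "\<And>z. norm z < R \<Longrightarrow> summable (\<lambda>n. d n * z ^ n)" and u: "norm u < R"
  shows "euler_eq (of_real \<alpha>) (\<lambda>z. \<Sum>n. of_real (\<alpha> / (\<alpha> + n)) * d n * z ^ n) u
           (of_real \<alpha> * (\<Sum>n. d n * u ^ n))"
proof -
  define c where "c n = of_real (\<alpha> / (\<alpha> + n)) * d n" for n
  have summ: "summable (\<lambda>n. c n * z ^ n)" if "norm z < R" for z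
    unfolding c_def by (rule summable_damped_powser[OF \<alpha> conv that])
  define S' where "S' = (\<Sum>n. diffs c n * u ^ n)"
  have der: "((\<lambda>z. \<Sum>n. c n * z ^ n) has_field_derivative S') (at u)"
    unfolding S'_def by (rule termdiffs_strong'[where K=R]) (use summ u in auto)
  define g where "g n = of_nat n * c n * u ^ n" for n
  have "(\<lambda>n. u * (diffs c n * u ^ n)) sums (u * S')"
    unfolding S'_def by (intro sums_mult summable_sums termdiff_converges[where K=R]) (use summ u in auto)
  moreover have "(\<lambda>n. u * (diffs c n * u ^ n)) = (\<lambda>n. g (Suc n))"
    by (simp add: fun_eq_iff g_def diffs_def mult_ac)
  ultimately have "(\<lambda>n. g (Suc n)) sums (u * S')" by simp
  then have g_sums: "g sums (u * S')" by (subst (asm) sums_Suc_iff) (simp add: g_def)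
  have c_sums: "(\<lambda>n. of_real \<alpha> * (c n * u ^ n)) sums (of_real \<alpha> * (\<Sum>n. c n * u ^ n))"
    by (intro sums_mult summable_sums summ u)
  have combine: "of_real \<alpha> * (c n * u ^ n) + g n = of_real \<alpha> * (d n * u ^ n)" for n
  proof -
    have "(of_real \<alpha> + of_nat n :: complex) = of_real (\<alpha> + n)" by simp
    moreover have "\<alpha> + n \<noteq> 0" using \<alpha> by linarith
    ultimately have ne: "(of_real \<alpha> + of_nat n :: complex) \<noteq> 0" by (metis of_real_eq_0_iff)
    have "of_real \<alpha> * (c n * u ^ n) + g n
          = (of_real \<alpha> + of_nat n) * (of_real \<alpha> / (of_real \<alpha> + of_nat n)) * (d n * u ^ n)"
      by (simp add: c_def g_def algebra_simps add_divide_distrib)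
    also have "\<dots> = of_real \<alpha> * (d n * u ^ n)" using ne by simp
    finally show ?thesis .
  qed
  have "(\<lambda>n. of_real \<alpha> * (d n * u ^ n)) sums (of_real \<alpha> * (\<Sum>n. c n * u ^ n) + u * S')"
    using sums_add[OF c_sums g_sums] unfolding combine .
  moreover have "(\<lambda>n. of_real \<alpha> * (d n * u ^ n)) sums (of_real \<alpha> * (\<Sum>n. d n * u ^ n))"
    by (intro sums_mult summable_sums conv u)
  ultimately have "of_real \<alpha> * (\<Sum>n. c n * u ^ n) + u * S' = of_real \<alpha> * (\<Sum>n. d n * u ^ n)"
    by (rule sums_unique2)
  then show ?thesis using der unfolding euler_eq_def c_def by blast
qed

lemma euler_eq_appell_F1:
  fixes \<alpha> e e' :: real and x y u :: complex
  assumes \<alpha>: "0 < \<alpha>" and e: "0 \<le> e" "e \<le> 1" "0 \<le> e'" "e' \<le> 1"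
    and xy: "norm x < 1" "norm y < 1" and u: "norm u < 1"
  shows "euler_eq (of_real \<alpha>)
           (\<lambda>v. appell_F1 (of_real \<alpha>) (of_real e) (of_real e') (of_real \<alpha> + 1) (x * v) (y * v)) u
           (of_real \<alpha> * ((1 - x * u) powr (- of_real e) * (1 - y * u) powr (- of_real e')))"
proof -
  have small: "norm (x * v) < 1" "norm (y * v) < 1" if "norm v < 1" for v
  proof -
    have "norm x * norm v < 1 * 1" "norm y * norm v < 1 * 1"
      using xy that by (intro mult_strict_mono; simp)+
    then show "norm (x * v) < 1" "norm (y * v) < 1" by (simp_all add: norm_mult)
  qed
  have sums: "(\<lambda>n. binom_prod e e' x y n * v ^ n)
                sums ((1 - x * v) powr (- of_real e) * (1 - y * v) powr (- of_real e'))"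
    if "norm v < 1" for v
  proof -
    have "binom_prod e e' (x * v) (y * v) = (\<lambda>n. binom_prod e e' x y n * v ^ n)"
      by (simp add: fun_eq_iff binom_prod_scale)
    then show ?thesis using binom_prod_sums[OF e small[OF that]] by simp
  qed
  have "euler_eq (of_real \<alpha>) (\<lambda>v. \<Sum>n. of_real (\<alpha> / (\<alpha> + n)) * binom_prod e e' x y n * v ^ n) u
          (of_real \<alpha> * (\<Sum>n. binom_prod e e' x y n * u ^ n))"
    by (rule euler_eq_powser[OF \<alpha> _ u]) (use sums in \<open>auto simp: sums_iff\<close>)
  then have "euler_eq (of_real \<alpha>) (\<lambda>v. \<Sum>n. of_real (\<alpha> / (\<alpha> + n)) * binom_prod e e' x y n * v ^ n) u
          (of_real \<alpha> * ((1 - x * u) powr (- of_real e) * (1 - y * u) powr (- of_real e')))"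
    using sums[OF u] by (simp add: sums_iff)
  then show ?thesis
  proof (rule euler_eq_transform[where S="ball 0 1"])
    fix v :: complex assume "v \<in> ball 0 1"
    then show "(\<Sum>n. of_real (\<alpha> / (\<alpha> + n)) * binom_prod e e' x y n * v ^ n)
               = appell_F1 (of_real \<alpha>) (of_real e) (of_real e') (of_real \<alpha> + 1) (x * v) (y * v)"
      using appell_F1_diagonal[OF \<alpha> e small] by (simp add: binom_prod_scale mult.assoc)
  qed (use u in auto)
qed

text \<open>The combination of two Appell functions that occurs in the theorem: the second one, with
  parameters raised by one and multiplied by the variable, enters with parameter \<open>\<alpha>\<close> again.\<close>
lemma euler_eq_appell_combination:
  fixes \<alpha> e :: real and x y u k l :: complex
  assumes \<alpha>: "0 < \<alpha>" and e: "0 \<le> e" "e \<le> 1" and xy: "norm x < 1" "norm y < 1" and u: "norm u < 1"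
  shows "euler_eq (of_real \<alpha>)
           (\<lambda>w. k * appell_F1 (of_real \<alpha>) (of_real e) (of_real e) (of_real \<alpha> + 1) (x * w) (y * w)
              + l * (w * appell_F1 (of_real (\<alpha> + 1)) (of_real e) (of_real e) (of_real (\<alpha> + 1) + 1) (y * w) (x * w)))
           u ((k * of_real \<alpha> + l * of_real (\<alpha> + 1) * u)
                * ((1 - x * u) powr (- of_real e) * (1 - y * u) powr (- of_real e)))"
proof -
  define P where "P = (1 - x * u) powr (- of_real e) * (1 - y * u) powr (- of_real e)"
  have "0 < \<alpha> + 1" using \<alpha> by simp
  from euler_eq_appell_F1[OF this e e xy(2,1) u]
  have "euler_eq (of_real \<alpha> + 1)
      (\<lambda>w. appell_F1 (of_real (\<alpha> + 1)) (of_real e) (of_real e) (of_real (\<alpha> + 1) + 1) (y * w) (x * w))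
      u (of_real (\<alpha> + 1) * P)"
    by (simp add: P_def mult.commute)
  from euler_eq_add[OF euler_eq_cmult[OF euler_eq_appell_F1[OF \<alpha> e e xy u]] euler_eq_cmult[OF euler_eq_shift[OF this]]]
  have "euler_eq (of_real \<alpha>)
           (\<lambda>w. k * appell_F1 (of_real \<alpha>) (of_real e) (of_real e) (of_real \<alpha> + 1) (x * w) (y * w)
              + l * (w * appell_F1 (of_real (\<alpha> + 1)) (of_real e) (of_real e) (of_real (\<alpha> + 1) + 1) (y * w) (x * w)))
           u (k * (of_real \<alpha> * P) + l * (u * (of_real (\<alpha> + 1) * P)))"
    by (simp only: P_def)
  moreover have "k * (of_real \<alpha> * P) + l * (u * (of_real (\<alpha> + 1) * P))
                 = (k * of_real \<alpha> + l * of_real (\<alpha> + 1) * u) * P"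
    by (simp add: algebra_simps)
  ultimately show ?thesis unfolding P_def by simp
qed

section \<open>Radial integration of the Euler equation\<close>

lemma euler_eq_scaled_primitive:
  fixes A w x :: complex and B h :: "complex \<Rightarrow> complex"
  assumes x: "x \<in> \<real>" "0 < Re x" and eq: "euler_eq A B (x * w) (x * w * h (x * w))"
  shows "((\<lambda>y. y powr A * (w powr A * B (y * w))) has_field_derivative (x * w) powr A * h (x * w) * w) (at x)"
proof -
  define u where "u = x * w"
  obtain B' where dB: "(B has_field_derivative B') (at u)" and hB: "A * B u + u * B' = u * h u"
    using eq unfolding euler_eq_def u_def by blast
  have x_nonpos: "x \<notin> \<real>\<^sub>\<le>\<^sub>0" using x by (auto simp: nonpos_Reals_def)
  have x_pow: "x powr A = x * x powr (A - 1)"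
  proof -
    have "x \<noteq> 0" using x by auto
    have "x powr A = x powr (1 + (A - 1))" by simp
    also have "\<dots> = x * x powr (A - 1)" unfolding powr_add using \<open>x \<noteq> 0\<close> by simp
    finally show ?thesis .
  qed
  have dBw: "((\<lambda>y. B (y * w)) has_field_derivative B' * (1 * w)) (at x)"
    using DERIV_chain'[OF DERIV_cmult_right[OF DERIV_ident, of w x UNIV] dB[unfolded u_def]] .
  have "((\<lambda>y. y powr A * (w powr A * B (y * w))) has_field_derivative
          (A * x powr (A - 1)) * (w powr A * B (x * w)) + (w powr A * (B' * (1 * w))) * x powr A) (at x)"
    by (rule DERIV_mult[OF has_field_derivative_powr[OF x_nonpos] DERIV_cmult[OF dBw]])
  also have "(A * x powr (A - 1)) * (w powr A * B (x * w)) + (w powr A * (B' * (1 * w))) * x powr A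
             = w powr A * x powr (A - 1) * (A * B u + u * B')"
    unfolding x_pow by (simp add: u_def algebra_simps)
  also have "\<dots> = (x * w) powr A * h (x * w) * w"
  proof -
    have "(x * w) powr A = x powr A * w powr A"
      by (rule powr_times_real_left) (use x in auto)
    then show ?thesis unfolding hB by (simp add: x_pow u_def algebra_simps)
  qed
  finally show ?thesis .
qed

text \<open>Hence, by the fundamental theorem of calculus, \<open>w^A B(w)\<close> is the integral of
  \<open>(t w)^A h(t w) w\<close> over \<open>[0, 1]\<close>; continuity at \<open>t = 0\<close> needs \<open>Re A > 0\<close>.\<close>
lemma euler_eq_radial_integral:
  fixes A w :: complex and B h :: "complex \<Rightarrow> complex" and R :: real
  assumes A: "0 < Re A" and eq: "\<And>u. norm u < R \<Longrightarrow> euler_eq A B u (u * h u)" and w: "norm w < R"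
  shows "((\<lambda>t. (of_real t * w) powr A * h (of_real t * w) * w) has_integral w powr A * B w) {0..1}"
proof -
  define F where "F x = x powr A * (w powr A * B (x * w))" for x :: complex
  have inside: "norm (of_real t * w) < R" if "t \<in> {0..1}" for t :: real
  proof -
    have "norm (of_real t * w) = \<bar>t\<bar> * norm w" by (simp add: norm_mult)
    also have "\<dots> \<le> 1 * norm w" using that by (intro mult_right_mono) auto
    finally show ?thesis using w by simp
  qed
  have cont: "continuous_on {0..1} (\<lambda>t. F (of_real t))"
    unfolding F_def
  proof (intro continuous_intros)
    show "continuous_on {0..1} (\<lambda>t. B (of_real t * w))"
    proof (intro continuous_at_imp_continuous_on ballI)
      fix t :: real assume t: "t \<in> {0..1}"
      show "isCont (\<lambda>t. B (of_real t * w)) t"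
      proof (rule isCont_o2[where f="\<lambda>t. of_real t * w" and g=B])
        show "isCont (\<lambda>t. of_real t * w) t" by (intro continuous_intros)
        show "isCont B (of_real t * w)"
          using eq[OF inside[OF t]] DERIV_isCont unfolding euler_eq_def by blast
      qed
    qed
    show "{0..1} \<subseteq> {t. 0 \<le> Re (complex_of_real t) \<or> Im (complex_of_real t) \<noteq> 0}" by auto
    show "\<And>t. t \<in> {0..1} \<Longrightarrow> complex_of_real t = 0 \<Longrightarrow> 0 < Re A" using A by auto
  qed
  have der: "((\<lambda>t. F (of_real t)) has_vector_derivative (of_real t * w) powr A * h (of_real t * w) * w) (at t)"
    if t: "t \<in> {0<..<1}" for t :: real
    using t eq[OF inside, of t]
    by (intro has_vector_derivative_real_field) (auto simp: F_def intro!: euler_eq_scaled_primitive)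
  have "((\<lambda>t. (of_real t * w) powr A * h (of_real t * w) * w) has_integral (F (of_real 1) - F (of_real 0))) {0..1}"
    by (rule fundamental_theorem_of_calculus_interior[OF _ cont der]) auto
  then show ?thesis by (simp add: F_def)
qed

text \<open>The polynomial identity behind the theorem: with \<open>a = (p - t)/p\<close> and \<open>b = (p + t)/(2p)\<close>,
  the quadratic \<open>Q\<close> and its derivative satisfy \<open>a Q + b u Q' = (u - 1)(2u - 4(p - t)/(p + t))\<close>.\<close>
lemma quad_identity:
  fixes p t u :: "'a::field_char_0"
  assumes p: "p \<noteq> 0" and pt: "p + t \<noteq> 0"
  shows "(p - t) / p * ((p * (u - 2)\<^sup>2 + t * u\<^sup>2) / (p + t))
           + (p + t) / (2 * p) * u * ((2 * p * (u - 2) + 2 * t * u) / (p + t))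
         = (u - 1) * (2 * u - 4 * (p - t) / (p + t))"
proof -
  define A1 where "A1 = (p - t) / p * ((p * (u - 2)\<^sup>2 + t * u\<^sup>2) / (p + t))"
  define A2 where "A2 = (p + t) / (2 * p) * ((2 * p * (u - 2) + 2 * t * u) / (p + t))"
  define A3 where "A3 = 4 * (p - t) / (p + t)"
  have h1: "A1 * (p * (p + t)) = (p - t) * (p * (u - 2)\<^sup>2 + t * u\<^sup>2)" using p pt by (simp add: A1_def)
  have "2 * p * (u - 2) + 2 * t * u = 2 * (p * (u - 2) + t * u)" by (simp add: algebra_simps)
  then have h2: "A2 * p = p * (u - 2) + t * u" unfolding A2_def using p pt by simp
  have h3: "A3 * (p + t) = 4 * (p - t)" using pt by (simp add: A3_def)
  have "(A1 + A2 * u - (u - 1) * (2 * u - A3)) * (p * (p + t)) = 0"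
    using h1 h2 h3 unfolding power2_eq_square by algebra
  then have "A1 + A2 * u = (u - 1) * (2 * u - A3)" using p pt by simp
  then show ?thesis by (simp add: A1_def A2_def A3_def mult_ac)
qed

text \<open>Applying the Euler operator to \<open>-Q E/(u - 1)\<close>, given the identity above.\<close>
lemma euler_quotient_algebra:
  fixes a b Q Q' E u c :: complex
  assumes "u \<noteq> 1" "a * Q + b * u * Q' = (u - 1) * c"
  shows "a * (- (Q * E / (u - 1))) + u * (- ((b * E * Q' * (u - 1) - Q * E * 1) / ((u - 1) * (u - 1))))
         = E * (u * Q / (u - 1)\<^sup>2 - c)"
proof -
  have "a * (- (Q * E / v)) + u * (- ((b * E * Q' * v - Q * E * 1) / (v * v)))
        = E * (u * Q / v\<^sup>2 - (a * Q + b * u * Q') / v)" if "v \<noteq> 0" for v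
    using that by (simp add: field_simps power2_eq_square)
  moreover have "u - 1 \<noteq> 0" using assms by simp
  ultimately show ?thesis using assms(2) by simp
qed

definition lead_exp :: "real \<Rightarrow> real" where "lead_exp \<theta> = 1 - \<theta> / pi"
definition binom_exp :: "real \<Rightarrow> real" where "binom_exp \<theta> = (pi - \<theta>) / (2 * pi)"
definition quad_exp :: "real \<Rightarrow> real" where "quad_exp \<theta> = (pi + \<theta>) / (2 * pi)"

text \<open>The quadratic of the integrand, written in the variable \<open>w = \<zeta> + 1\<close>.\<close>
definition quad :: "real \<Rightarrow> complex \<Rightarrow> complex" where
  "quad \<theta> w = (of_real pi * (w - 2)\<^sup>2 + of_real \<theta> * w\<^sup>2) / of_real (pi + \<theta>)"

text \<open>The numbers \<open>\<lambda>1, \<lambda>2\<close> with \<open>\<xi>(z) = \<lambda>1 (z + 1)\<close> and \<open>\<eta>(z) = \<lambda>2 (z + 1)\<close>.\<close>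
definition xi_coeff :: "real \<Rightarrow> complex" where
  "xi_coeff \<theta> = Complex (1/2) (- (sqrt \<theta> / (2 * sqrt pi)))"

definition eta_coeff :: "real \<Rightarrow> complex" where
  "eta_coeff \<theta> = Complex (1/2) (sqrt \<theta> / (2 * sqrt pi))"

definition outer_const :: "real \<Rightarrow> real" where
  "outer_const \<theta> = 2 powr (\<theta> / pi) * pi powr ((pi + \<theta>) / (2 * pi)) / (2 * pi\<^sup>2 + pi * \<theta> - \<theta>\<^sup>2)"

text \<open>The bracket of the theorem as a function of \<open>w = z + 1\<close>, with \<open>\<delta>/\<psi>\<close> replaced by its
  constant value \<open>(\<pi> + \<theta>)^e\<close>.\<close>
definition regular_factor :: "real \<Rightarrow> complex \<Rightarrow> complex" where
  "regular_factor \<theta> w =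
     - (quad \<theta> w powr of_real (quad_exp \<theta>) / (w - 1))
     + of_real (outer_const \<theta> * (pi + \<theta>) powr binom_exp \<theta>)
       * (- 2 * of_real (2 * pi - \<theta>)
            * appell_F1 (of_real (lead_exp \<theta>)) (of_real (binom_exp \<theta>)) (of_real (binom_exp \<theta>))
                (of_real (lead_exp \<theta>) + 1) (xi_coeff \<theta> * w) (eta_coeff \<theta> * w)
          + of_real (pi + \<theta>)
            * (w * appell_F1 (of_real (lead_exp \<theta> + 1)) (of_real (binom_exp \<theta>)) (of_real (binom_exp \<theta>))
                     (of_real (lead_exp \<theta> + 1) + 1) (eta_coeff \<theta> * w) (xi_coeff \<theta> * w)))"

definition closed_form :: "real \<Rightarrow> complex \<Rightarrow> complex" where
  "closed_form \<theta> z =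
      (z + 1) powr (of_real (1 - \<theta> / pi)) *
      ( - phi_fn \<theta> z / z
        + of_real (2 powr (\<theta> / pi) * pi powr ((pi + \<theta>) / (2 * pi))
                   / (2 * pi\<^sup>2 + pi * \<theta> - \<theta>\<^sup>2))
          * (delta_fn \<theta> z / psi_fn \<theta> z)
          * ( - 2 * of_real (2 * pi - \<theta>)
                * appell_F1 (of_real (1 - \<theta> / pi)) (of_real ((pi - \<theta>) / (2 * pi)))
                    (of_real ((pi - \<theta>) / (2 * pi))) (of_real (2 - \<theta> / pi))
                    (xi_fn \<theta> z) (eta_fn \<theta> z)
              + of_real (pi + \<theta>) * (z + 1)
                * appell_F1 (of_real (2 - \<theta> / pi)) (of_real ((pi - \<theta>) / (2 * pi)))
                    (of_real ((pi - \<theta>) / (2 * pi))) (of_real (3 - \<theta> / pi))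
                    (eta_fn \<theta> z) (xi_fn \<theta> z)))"

locale opening_angle =
  fixes \<theta> :: real
  assumes pos: "0 < \<theta>" and lt_pi: "\<theta> < pi"
begin

lemma exponents:
  "0 < lead_exp \<theta>" "0 \<le> binom_exp \<theta>" "binom_exp \<theta> \<le> 1" "quad_exp \<theta> = 1 - binom_exp \<theta>"
  using pos lt_pi pi_gt_zero by (auto simp: lead_exp_def binom_exp_def quad_exp_def field_simps)

lemma angle_facts: "0 < pi + \<theta>" "0 < 2 * pi - \<theta>" "2 * pi\<^sup>2 + pi * \<theta> - \<theta>\<^sup>2 = (2 * pi - \<theta>) * (pi + \<theta>)"
  using pos lt_pi pi_gt_zero by (auto simp: power2_eq_square algebra_simps)

text \<open>Both coefficients have modulus below \<open>3/4\<close>, so \<open>\<xi>, \<eta>\<close> stay in the unit disc for \<open>|w| < 1/4\<close>.\<close>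
lemma norm_coeffs: "norm (xi_coeff \<theta>) < 3/4" "norm (eta_coeff \<theta>) < 3/4"
proof -
  have "(sqrt \<theta> / (2 * sqrt pi))\<^sup>2 = \<theta> / (4 * pi)"
    using pos by (simp add: power_divide power_mult_distrib)
  also have "\<dots> < 1/4" using lt_pi pi_gt_zero by (simp add: field_simps)
  finally have "(sqrt \<theta> / (2 * sqrt pi))\<^sup>2 < 1/4" .
  moreover have "(1/2::real)\<^sup>2 = 1/4" "(3/4::real)\<^sup>2 = 9/16" by (simp_all add: power2_eq_square)
  ultimately have "(1/2)\<^sup>2 + (sqrt \<theta> / (2 * sqrt pi))\<^sup>2 < (3/4 :: real)\<^sup>2" by linarith
  then have "sqrt ((1/2)\<^sup>2 + (sqrt \<theta> / (2 * sqrt pi))\<^sup>2) < sqrt ((3/4)\<^sup>2)"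
    by (subst real_sqrt_less_iff) simp
  then show "norm (xi_coeff \<theta>) < 3/4" "norm (eta_coeff \<theta>) < 3/4"
    by (simp_all only: xi_coeff_def eta_coeff_def complex_norm power2_minus) simp_all
qed

text \<open>The quadratic factors through \<open>\<lambda>1, \<lambda>2\<close>: \<open>\<lambda>1 + \<lambda>2 = 1\<close> and \<open>\<lambda>1 \<lambda>2 = (\<pi> + \<theta>)/(4\<pi>)\<close>.\<close>
lemma coeffs_factorization:
  "(1 - xi_coeff \<theta> * u) * (1 - eta_coeff \<theta> * u) = of_real ((pi + \<theta>) / (4 * pi)) * quad \<theta> u"
proof -
  have sum: "xi_coeff \<theta> + eta_coeff \<theta> = 1" by (simp add: xi_coeff_def eta_coeff_def complex_eq_iff)
  have "(sqrt \<theta> / (2 * sqrt pi)) * (sqrt \<theta> / (2 * sqrt pi)) = \<theta> / (4 * pi)"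
    using pos by (simp add: field_simps)
  then have prod: "xi_coeff \<theta> * eta_coeff \<theta> = of_real ((pi + \<theta>) / (4 * pi))"
    using pi_gt_zero by (simp add: xi_coeff_def eta_coeff_def complex_eq_iff field_simps)
  have "(1 - xi_coeff \<theta> * u) * (1 - eta_coeff \<theta> * u)
        = 1 - (xi_coeff \<theta> + eta_coeff \<theta>) * u + (xi_coeff \<theta> * eta_coeff \<theta>) * u\<^sup>2"
    by (simp add: algebra_simps power2_eq_square)
  also have "\<dots> = of_real ((pi + \<theta>) / (4 * pi)) * quad \<theta> u"
  proof -
    have ne: "(of_real pi :: complex) \<noteq> 0" "(of_real (pi + \<theta>) :: complex) \<noteq> 0"
      using angle_facts pi_gt_zero by (simp_all del: of_real_add)
    show ?thesis unfolding sum prod quad_def using ne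
      by (simp add: field_simps power2_eq_square del: of_real_add) (simp add: algebra_simps)
  qed
  finally show ?thesis .
qed

text \<open>Near \<open>w = 0\<close> the quadratic stays in the right half-plane, so its principal powers are analytic.\<close>
lemma Re_quad_pos:
  assumes "norm u < 1/4"
  shows "0 < Re (quad \<theta> u)"
proof -
  define c where "c = 4 * pi / (pi + \<theta>)"
  have c: "2 < c" using pos lt_pi pi_gt_zero by (simp add: c_def field_simps)
  have "(of_real (pi + \<theta>) :: complex) \<noteq> 0" using angle_facts by (simp del: of_real_add)
  then have "quad \<theta> u = of_real c * (1 - u) + u\<^sup>2"
    unfolding quad_def c_def by (simp add: field_simps power2_eq_square del: of_real_add) (simp add: algebra_simps)
  then have "Re (quad \<theta> u) = c * (1 - Re u) + Re (u\<^sup>2)" by simp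
  moreover have "Re u \<le> 1/4" using assms complex_Re_le_cmod[of u] by linarith
  moreover have "- (1/16) \<le> Re (u\<^sup>2)"
  proof -
    have "norm (u\<^sup>2) \<le> (1/4)\<^sup>2" unfolding norm_power using assms by (intro power_mono) auto
    then show ?thesis using abs_Re_le_cmod[of "u\<^sup>2"] by (simp add: power2_eq_square)
  qed
  moreover have "c * (1 - Re u) \<ge> 2 * (3/4)" using c \<open>Re u \<le> 1/4\<close> by (intro mult_mono) auto
  ultimately show ?thesis by linarith
qed

lemma Re_one_minus_pos:
  assumes "norm l < 3/4" "norm u < 1/4"
  shows "0 < Re (1 - l * u)"
proof -
  have "norm (l * u) \<le> 3/4 * (1/4)" unfolding norm_mult using assms by (intro mult_mono) auto
  then show ?thesis using complex_Re_le_cmod[of "l * u"] by simp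
qed

lemma coeffs_powr_product:
  assumes "norm u < 1/4"
  shows "(1 - xi_coeff \<theta> * u) powr (- of_real (binom_exp \<theta>)) * (1 - eta_coeff \<theta> * u) powr (- of_real (binom_exp \<theta>))
         = of_real (((pi + \<theta>) / (4 * pi)) powr (- binom_exp \<theta>)) * quad \<theta> u powr (- of_real (binom_exp \<theta>))"
proof -
  have nonneg: "0 \<le> (pi + \<theta>) / (4 * pi)" using angle_facts pi_gt_zero by simp
  have "(1 - xi_coeff \<theta> * u) powr (- of_real (binom_exp \<theta>)) * (1 - eta_coeff \<theta> * u) powr (- of_real (binom_exp \<theta>))
        = ((1 - xi_coeff \<theta> * u) * (1 - eta_coeff \<theta> * u)) powr (- of_real (binom_exp \<theta>))"
    by (rule powr_mult_Re_pos[symmetric]) (use Re_one_minus_pos norm_coeffs assms in auto)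
  also have "\<dots> = of_real ((pi + \<theta>) / (4 * pi)) powr (- of_real (binom_exp \<theta>)) * quad \<theta> u powr (- of_real (binom_exp \<theta>))"
    unfolding coeffs_factorization using nonneg by (intro powr_times_real_left) auto
  also have "of_real ((pi + \<theta>) / (4 * pi)) powr (- of_real (binom_exp \<theta>))
             = (of_real (((pi + \<theta>) / (4 * pi)) powr (- binom_exp \<theta>)) :: complex)"
    unfolding of_real_minus[symmetric] by (rule powr_of_real[OF nonneg])
  finally show ?thesis .
qed

lemma outer_const_normalized:
  "outer_const \<theta> * (pi + \<theta>) powr binom_exp \<theta> * ((pi + \<theta>) / (4 * pi)) powr (- binom_exp \<theta>)
   = 2 * pi / ((pi + \<theta>) * (2 * pi - \<theta>))"
proof -
  define e where "e = binom_exp \<theta>"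
  have p: "0 < pi" "0 < pi + \<theta>" "0 < 2 * pi - \<theta>" using angle_facts pi_gt_zero by auto
  have "(pi + \<theta>) powr e * ((pi + \<theta>) / (4 * pi)) powr (- e) = (4 * pi) powr e"
    using p by (simp add: powr_divide powr_minus field_simps)
  also have "\<dots> = 2 powr (2 * e) * pi powr e"
  proof -
    have "(4::real) = 2 powr 2" by simp
    then have "(4::real) powr e = 2 powr (2 * e)" by (metis powr_powr)
    then show ?thesis by (simp add: powr_mult)
  qed
  finally have four: "(pi + \<theta>) powr e * ((pi + \<theta>) / (4 * pi)) powr (- e) = 2 powr (2 * e) * pi powr e" .
  have two: "2 powr (\<theta> / pi) * 2 powr (2 * e) = 2"
    using p by (simp add: powr_add[symmetric] e_def binom_exp_def field_simps)
  have pi: "pi powr ((pi + \<theta>) / (2 * pi)) * pi powr e = pi"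
    using p by (simp add: powr_add[symmetric] e_def binom_exp_def field_simps)
  have "outer_const \<theta> * (pi + \<theta>) powr e * ((pi + \<theta>) / (4 * pi)) powr (- e)
        = (2 powr (\<theta> / pi) * 2 powr (2 * e)) * (pi powr ((pi + \<theta>) / (2 * pi)) * pi powr e)
          / ((2 * pi - \<theta>) * (pi + \<theta>))"
    unfolding outer_const_def angle_facts(3) mult.assoc four by (simp add: mult_ac)
  also have "\<dots> = 2 * pi / ((2 * pi - \<theta>) * (pi + \<theta>))" by (simp only: two pi)
  also have "\<dots> = 2 * pi / ((pi + \<theta>) * (2 * pi - \<theta>))" by (simp only: mult.commute)
  finally show ?thesis unfolding e_def .
qed

lemma appell_coefficients:
  defines "KM \<equiv> (of_real (outer_const \<theta> * (pi + \<theta>) powr binom_exp \<theta>)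
                 * of_real (((pi + \<theta>) / (4 * pi)) powr (- binom_exp \<theta>)) :: complex)"
  shows "KM * (- 2 * of_real (2 * pi - \<theta>) * of_real (lead_exp \<theta>)) = - of_real (4 * (pi - \<theta>) / (pi + \<theta>))"
    and "KM * (of_real (pi + \<theta>) * of_real (lead_exp \<theta> + 1)) = 2"
proof -
  have KM: "KM = of_real (2 * pi / ((pi + \<theta>) * (2 * pi - \<theta>)))"
    unfolding KM_def outer_const_normalized[symmetric] by simp
  have ne: "pi + \<theta> \<noteq> 0" "2 * pi - \<theta> \<noteq> 0" using angle_facts by auto
  have pi_a: "pi * lead_exp \<theta> = pi - \<theta>" using pi_gt_zero by (simp add: lead_exp_def field_simps)
  have cancel: "2 * pi / (x * y) * (- 2 * y * a) = - (4 * (pi * a) / x)"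
    "2 * pi / (x * y) * (x * (a + 1)) = 2 * (pi * a + pi) / y" if "x \<noteq> 0" "y \<noteq> 0" for x y a
    using that by (simp_all add: field_simps)
  have "2 * pi / ((pi + \<theta>) * (2 * pi - \<theta>)) * (- 2 * (2 * pi - \<theta>) * lead_exp \<theta>) = - (4 * (pi - \<theta>) / (pi + \<theta>))"
    unfolding cancel(1)[OF ne] pi_a ..
  from arg_cong[OF this, of "of_real :: real \<Rightarrow> complex"]
  show "KM * (- 2 * of_real (2 * pi - \<theta>) * of_real (lead_exp \<theta>)) = - of_real (4 * (pi - \<theta>) / (pi + \<theta>))"
    unfolding KM by simp
  have two: "2 * pi / ((pi + \<theta>) * (2 * pi - \<theta>)) * ((pi + \<theta>) * (lead_exp \<theta> + 1)) = 2"
    unfolding cancel(2)[OF ne] pi_a using ne(2) by (simp add: field_simps)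
  have "KM * (of_real (pi + \<theta>) * of_real (lead_exp \<theta> + 1))
        = of_real (2 * pi / ((pi + \<theta>) * (2 * pi - \<theta>)) * ((pi + \<theta>) * (lead_exp \<theta> + 1)))"
    unfolding KM by (simp only: of_real_mult)
  then show "KM * (of_real (pi + \<theta>) * of_real (lead_exp \<theta> + 1)) = 2" unfolding two by simp
qed

lemma euler_appell_part:
  assumes u: "norm u < 1/4"
  shows "euler_eq (of_real (lead_exp \<theta>))
           (\<lambda>w. of_real (outer_const \<theta> * (pi + \<theta>) powr binom_exp \<theta>)
              * (- 2 * of_real (2 * pi - \<theta>)
                   * appell_F1 (of_real (lead_exp \<theta>)) (of_real (binom_exp \<theta>)) (of_real (binom_exp \<theta>))
                       (of_real (lead_exp \<theta>) + 1) (xi_coeff \<theta> * w) (eta_coeff \<theta> * w)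
                 + of_real (pi + \<theta>)
                   * (w * appell_F1 (of_real (lead_exp \<theta> + 1)) (of_real (binom_exp \<theta>)) (of_real (binom_exp \<theta>))
                            (of_real (lead_exp \<theta> + 1) + 1) (eta_coeff \<theta> * w) (xi_coeff \<theta> * w))))
           u (quad \<theta> u powr (- of_real (binom_exp \<theta>)) * (2 * u - of_real (4 * (pi - \<theta>) / (pi + \<theta>))))"
proof -
  define E where "E = quad \<theta> u powr (- of_real (binom_exp \<theta>))"
  define M where "M = (of_real (((pi + \<theta>) / (4 * pi)) powr (- binom_exp \<theta>)) :: complex)"
  define K where "K = (of_real (outer_const \<theta> * (pi + \<theta>) powr binom_exp \<theta>) :: complex)"
  have nu: "norm u < 1" using u by simp
  have nc: "norm (xi_coeff \<theta>) < 1" "norm (eta_coeff \<theta>) < 1" using norm_coeffs by auto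
  have prod: "(1 - xi_coeff \<theta> * u) powr (- of_real (binom_exp \<theta>))
                * (1 - eta_coeff \<theta> * u) powr (- of_real (binom_exp \<theta>)) = M * E"
    using coeffs_powr_product[OF u] by (simp add: M_def E_def)
  have "K * ((- 2 * of_real (2 * pi - \<theta>) * of_real (lead_exp \<theta>)
              + of_real (pi + \<theta>) * of_real (lead_exp \<theta> + 1) * u) * (M * E))
        = E * ((K * M) * (- 2 * of_real (2 * pi - \<theta>) * of_real (lead_exp \<theta>))
               + (K * M) * (of_real (pi + \<theta>) * of_real (lead_exp \<theta> + 1)) * u)"
    by (simp add: algebra_simps)
  also have "\<dots> = E * (2 * u - of_real (4 * (pi - \<theta>) / (pi + \<theta>)))"
    unfolding K_def M_def appell_coefficients by (simp add: algebra_simps)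
  finally have euler_value: "K * ((- 2 * of_real (2 * pi - \<theta>) * of_real (lead_exp \<theta>)
              + of_real (pi + \<theta>) * of_real (lead_exp \<theta> + 1) * u) * (M * E))
        = E * (2 * u - of_real (4 * (pi - \<theta>) / (pi + \<theta>)))" .
  show ?thesis
    using euler_eq_cmult[OF euler_eq_appell_combination[where k = "- 2 * of_real (2 * pi - \<theta>)"
            and l = "of_real (pi + \<theta>)", OF exponents(1-3) nc nu], of K]
    unfolding prod euler_value unfolding K_def E_def .
qed

lemma quad_has_derivative:
  "(quad \<theta> has_field_derivative (2 * of_real pi * (u - 2) + 2 * of_real \<theta> * u) / of_real (pi + \<theta>)) (at u)"
proof -
  have "((\<lambda>x. of_real pi * (x - 2)\<^sup>2 + of_real \<theta> * x\<^sup>2) has_field_derivative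
          2 * of_real pi * (u - 2) + 2 * of_real \<theta> * u) (at u)"
    by (auto intro!: derivative_eq_intros simp: algebra_simps)
  then show ?thesis unfolding quad_def[abs_def] by (rule DERIV_cdivide)
qed

lemma quad_euler_identity:
  "of_real (lead_exp \<theta>) * quad \<theta> u
     + of_real (quad_exp \<theta>) * u * ((2 * of_real pi * (u - 2) + 2 * of_real \<theta> * u) / of_real (pi + \<theta>))
   = (u - 1) * (2 * u - of_real (4 * (pi - \<theta>) / (pi + \<theta>)))"
proof -
  define p where "p = (of_real pi :: complex)"
  define t where "t = (of_real \<theta> :: complex)"
  have p: "p \<noteq> 0" using pi_gt_zero by (simp add: p_def)
  have pt: "p + t \<noteq> 0" using angle_facts by (simp add: p_def t_def del: of_real_add flip: of_real_add)
  have "of_real (lead_exp \<theta>) = (p - t) / p" "of_real (quad_exp \<theta>) = (p + t) / (2 * p)"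
    "(of_real (4 * (pi - \<theta>) / (pi + \<theta>)) :: complex) = 4 * (p - t) / (p + t)"
    "quad \<theta> u = (p * (u - 2)\<^sup>2 + t * u\<^sup>2) / (p + t)" "(of_real (pi + \<theta>) :: complex) = p + t"
    using p by (simp_all add: lead_exp_def quad_exp_def quad_def p_def t_def field_simps)
  then show ?thesis unfolding p_def[symmetric] t_def[symmetric] by (simp only: quad_identity[OF p pt])
qed

text \<open>The term \<open>-Q^b/(w - 1)\<close> of the bracket solves the Euler equation with right-hand side
  \<open>Q^-e (u Q/(u - 1)^2 - (2u - 4(\<pi> - \<theta>)/(\<pi> + \<theta>)))\<close>; the second summand cancels the Appell part.\<close>
lemma euler_quadratic_part:
  assumes u: "norm u < 1/4"
  shows "euler_eq (of_real (lead_exp \<theta>)) (\<lambda>w. - (quad \<theta> w powr of_real (quad_exp \<theta>) / (w - 1))) u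
           (quad \<theta> u powr (- of_real (binom_exp \<theta>))
             * (u * quad \<theta> u / (u - 1)\<^sup>2 - (2 * u - of_real (4 * (pi - \<theta>) / (pi + \<theta>)))))"
proof -
  define Q where "Q = quad \<theta> u"
  define Q' where "Q' = (2 * of_real pi * (u - 2) + 2 * of_real \<theta> * u) / of_real (pi + \<theta>)"
  define b where "b = (of_real (quad_exp \<theta>) :: complex)"
  define E where "E = Q powr (- of_real (binom_exp \<theta>))"
  have u1: "u \<noteq> 1" using u by auto
  have Q_nonpos: "Q \<notin> \<real>\<^sub>\<le>\<^sub>0" using Re_quad_pos[OF u] by (auto simp: Q_def nonpos_Reals_def)
  have b1: "b = 1 + - of_real (binom_exp \<theta>)" using exponents(4) by (simp add: b_def)
  have "Q \<noteq> 0" using Q_nonpos by auto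
  then have Qb: "Q powr b = Q * E" unfolding b1 powr_add E_def by simp
  have Qb1: "Q powr (b - 1) = E" unfolding b1 E_def by simp
  have "((\<lambda>x. quad \<theta> x powr b) has_field_derivative (b * Q powr (b - 1)) * Q') (at u)"
    using DERIV_chain'[OF quad_has_derivative[of u] has_field_derivative_powr[OF Q_nonpos[unfolded Q_def]]]
    by (simp add: Q_def Q'_def)
  then have "((\<lambda>x. quad \<theta> x powr b / (x - 1)) has_field_derivative
          ((b * Q powr (b - 1)) * Q' * (u - 1) - quad \<theta> u powr b * (1 - 0)) / ((u - 1) * (u - 1))) (at u)"
    using u1 by (intro DERIV_divide derivative_intros) auto
  then have deriv: "((\<lambda>x. - (quad \<theta> x powr b / (x - 1))) has_field_derivative
          - (((b * E) * Q' * (u - 1) - (Q * E) * 1) / ((u - 1) * (u - 1)))) (at u)"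
    using DERIV_minus by (fastforce simp: Q_def[symmetric] Qb Qb1)
  have "of_real (lead_exp \<theta>) * Q + b * u * Q' = (u - 1) * (2 * u - of_real (4 * (pi - \<theta>) / (pi + \<theta>)))"
    unfolding Q_def b_def Q'_def by (rule quad_euler_identity)
  from euler_quotient_algebra[OF u1 this, of E]
  have "of_real (lead_exp \<theta>) * (- (Q powr b / (u - 1)))
          + u * (- ((b * E * Q' * (u - 1) - Q * E * 1) / ((u - 1) * (u - 1))))
        = E * (u * Q / (u - 1)\<^sup>2 - (2 * u - of_real (4 * (pi - \<theta>) / (pi + \<theta>))))"
    unfolding Qb .
  then show ?thesis
    unfolding euler_eq_def b_def[symmetric] Q_def[symmetric] E_def[symmetric] using deriv by blast
qed

lemma euler_regular_factor:
  assumes u: "norm u < 1/4"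
  shows "euler_eq (of_real (lead_exp \<theta>)) (regular_factor \<theta>) u
           (u * (quad \<theta> u powr of_real (quad_exp \<theta>) / (u - 1)\<^sup>2))"
proof -
  define E where "E = quad \<theta> u powr (- of_real (binom_exp \<theta>))"
  define c where "c = 2 * u - of_real (4 * (pi - \<theta>) / (pi + \<theta>))"
  have "quad \<theta> u \<noteq> 0" using Re_quad_pos[OF u] by auto
  moreover have b1: "(of_real (quad_exp \<theta>) :: complex) = 1 + - of_real (binom_exp \<theta>)"
    using exponents(4) by simp
  ultimately have Qb: "quad \<theta> u powr of_real (quad_exp \<theta>) = quad \<theta> u * E"
    unfolding E_def b1 powr_add by simp
  have "regular_factor \<theta> = (\<lambda>w. - (quad \<theta> w powr of_real (quad_exp \<theta>) / (w - 1))
     + of_real (outer_const \<theta> * (pi + \<theta>) powr binom_exp \<theta>)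
       * (- 2 * of_real (2 * pi - \<theta>)
            * appell_F1 (of_real (lead_exp \<theta>)) (of_real (binom_exp \<theta>)) (of_real (binom_exp \<theta>))
                (of_real (lead_exp \<theta>) + 1) (xi_coeff \<theta> * w) (eta_coeff \<theta> * w)
          + of_real (pi + \<theta>)
            * (w * appell_F1 (of_real (lead_exp \<theta> + 1)) (of_real (binom_exp \<theta>)) (of_real (binom_exp \<theta>))
                     (of_real (lead_exp \<theta> + 1) + 1) (eta_coeff \<theta> * w) (xi_coeff \<theta> * w))))"
    by (simp add: fun_eq_iff regular_factor_def)
  moreover have "E * (u * quad \<theta> u / (u - 1)\<^sup>2 - c) + E * c
                 = u * (quad \<theta> u powr of_real (quad_exp \<theta>) / (u - 1)\<^sup>2)"
    unfolding Qb by (simp add: algebra_simps)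
  ultimately show ?thesis
    using euler_eq_add[OF euler_quadratic_part[OF u] euler_appell_part[OF u]] by (simp add: E_def c_def)
qed

lemma integrand_eq:
  "integrand \<theta> \<zeta> = (\<zeta> + 1) powr of_real (lead_exp \<theta>) * (quad \<theta> (\<zeta> + 1) powr of_real (quad_exp \<theta>) / \<zeta>\<^sup>2)"
proof -
  define p where "p = (of_real pi :: complex)"
  define t where "t = (of_real \<theta> :: complex)"
  have pt: "p + t \<noteq> 0" using angle_facts by (simp add: p_def t_def del: of_real_add flip: of_real_add)
  have "\<zeta>\<^sup>2 - 2 * ((p - t) / (p + t)) * \<zeta> + 1 = (p * (\<zeta> + 1 - 2)\<^sup>2 + t * (\<zeta> + 1)\<^sup>2) / (p + t)"
    using pt by (simp add: field_simps power2_eq_square)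
  moreover have "of_real ((pi - \<theta>) / (pi + \<theta>)) = (p - t) / (p + t)" by (simp add: p_def t_def)
  ultimately show ?thesis
    by (simp add: integrand_def lead_exp_def quad_exp_def quad_def p_def t_def)
qed

text \<open>Integrating the Euler equation along the segment: \<open>f(z) = w^a B(w)\<close>.\<close>
lemma f_int_eq:
  assumes "norm (z + 1) < 1/4"
  shows "f_int \<theta> z = (z + 1) powr of_real (lead_exp \<theta>) * regular_factor \<theta> (z + 1)"
proof -
  define h where "h u = quad \<theta> u powr of_real (quad_exp \<theta>) / (u - 1)\<^sup>2" for u
  have "((\<lambda>t. (of_real t * (z + 1)) powr of_real (lead_exp \<theta>) * h (of_real t * (z + 1)) * (z + 1))
          has_integral (z + 1) powr of_real (lead_exp \<theta>) * regular_factor \<theta> (z + 1)) {0..1}"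
    by (rule euler_eq_radial_integral[OF _ _ assms])
       (use exponents(1) euler_regular_factor in \<open>auto simp: h_def\<close>)
  moreover have "(\<lambda>t. integrand \<theta> (-1 + of_real t * (z + 1)) * (z + 1))
                 = (\<lambda>t. (of_real t * (z + 1)) powr of_real (lead_exp \<theta>) * h (of_real t * (z + 1)) * (z + 1))"
    unfolding integrand_eq h_def by (simp add: fun_eq_iff algebra_simps)
  ultimately show ?thesis unfolding f_int_def by (simp only: integral_unique)
qed

lemma Re_linear_factor_pos:
  fixes c w :: complex
  assumes "norm c \<le> 2 * sqrt pi" "norm w < 1/4"
  shows "0 < Re (2 * of_real (sqrt pi) - c * w)"
proof -
  have "Re (c * w) \<le> norm (c * w)" by (rule complex_Re_le_cmod)
  also have "\<dots> \<le> 2 * sqrt pi * (1/4)" unfolding norm_mult using assms by (intro mult_mono) auto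
  finally have "Re (c * w) \<le> sqrt pi / 2" by simp
  moreover have "0 < sqrt pi" by simp
  moreover have "Re (2 * of_real (sqrt pi) - c * w) = 2 * sqrt pi - Re (c * w)" by simp
  ultimately show ?thesis by linarith
qed

text \<open>The product of the two factors of \<open>\<delta>\<close> is \<open>(\<pi> + \<theta>) Q\<close>, so \<open>\<delta>/\<psi>\<close> is the constant \<open>(\<pi> + \<theta>)^e\<close>.\<close>
lemma delta_over_psi:
  assumes w: "norm (z + 1) < 1/4"
  shows "delta_fn \<theta> z / psi_fn \<theta> z = of_real ((pi + \<theta>) powr binom_exp \<theta>)"
proof -
  define sp where "sp = (of_real (sqrt pi) :: complex)"
  define st where "st = (of_real (sqrt \<theta>) :: complex)"
  define f1 where "f1 = - sp * (z - 1) - \<i> * st * (z + 1)"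
  define f2 where "f2 = - sp * (z - 1) + \<i> * st * (z + 1)"
  define e where "e = (of_real (binom_exp \<theta>) :: complex)"
  have norms: "norm (sp + \<i> * st) \<le> 2 * sqrt pi" "norm (sp - \<i> * st) \<le> 2 * sqrt pi"
  proof -
    have "sqrt \<theta> \<le> sqrt pi" using lt_pi by simp
    moreover have "norm (sp + \<i> * st) \<le> norm sp + norm (\<i> * st)" "norm (sp - \<i> * st) \<le> norm sp + norm (\<i> * st)"
      by (rule norm_triangle_ineq, rule norm_triangle_ineq4)
    moreover have "norm sp + norm (\<i> * st) = sqrt pi + sqrt \<theta>" using pos by (simp add: sp_def st_def norm_mult)
    ultimately show "norm (sp + \<i> * st) \<le> 2 * sqrt pi" "norm (sp - \<i> * st) \<le> 2 * sqrt pi" by linarith+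
  qed
  have "f1 = 2 * of_real (sqrt pi) - (sp + \<i> * st) * (z + 1)" "f2 = 2 * of_real (sqrt pi) - (sp - \<i> * st) * (z + 1)"
    by (simp_all add: f1_def f2_def sp_def algebra_simps)
  then have Re_pos: "0 < Re f1" "0 < Re f2"
    using Re_linear_factor_pos[OF norms(1) w] Re_linear_factor_pos[OF norms(2) w] by simp_all
  have "f1 * f2 = (sp * sp) * (z - 1)\<^sup>2 + (st * st) * (z + 1)\<^sup>2"
    by (simp add: f1_def f2_def algebra_simps power2_eq_square)
  also have "\<dots> = of_real (pi + \<theta>) * quad \<theta> (z + 1)"
  proof -
    have "sp * sp = of_real pi" "st * st = of_real \<theta>" using pos by (simp_all add: sp_def st_def flip: of_real_mult)
    moreover have "(of_real (pi + \<theta>) :: complex) \<noteq> 0" using angle_facts by (simp del: of_real_add)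
    ultimately show ?thesis by (simp add: quad_def)
  qed
  finally have prod: "f1 * f2 = of_real (pi + \<theta>) * quad \<theta> (z + 1)" .
  have "delta_fn \<theta> z = f1 powr e * f2 powr e"
    by (simp add: delta_fn_def f1_def f2_def sp_def st_def e_def binom_exp_def)
  also have "\<dots> = (f1 * f2) powr e" by (rule powr_mult_Re_pos[symmetric, OF Re_pos])
  also have "\<dots> = of_real (pi + \<theta>) powr e * quad \<theta> (z + 1) powr e"
    unfolding prod using angle_facts by (intro powr_times_real_left) auto
  also have "of_real (pi + \<theta>) powr e = (of_real ((pi + \<theta>) powr binom_exp \<theta>) :: complex)"
    unfolding e_def using angle_facts by (intro powr_of_real) auto
  finally have delta: "delta_fn \<theta> z = of_real ((pi + \<theta>) powr binom_exp \<theta>) * quad \<theta> (z + 1) powr e" .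
  have psi: "psi_fn \<theta> z = quad \<theta> (z + 1) powr e" by (simp add: psi_fn_def quad_def e_def binom_exp_def)
  have "quad \<theta> (z + 1) powr e \<noteq> 0" using Re_quad_pos[OF w] by (auto simp: powr_def)
  then show ?thesis unfolding delta psi by simp
qed

lemma xi_eta_scaling: "xi_fn \<theta> z = xi_coeff \<theta> * (z + 1)" "eta_fn \<theta> z = eta_coeff \<theta> * (z + 1)"
proof -
  have "(of_real (sqrt pi) :: complex) \<noteq> 0" by simp
  then have "(of_real (sqrt pi) - \<i> * of_real (sqrt \<theta>)) / (2 * of_real (sqrt pi)) = xi_coeff \<theta>"
            "(of_real (sqrt pi) + \<i> * of_real (sqrt \<theta>)) / (2 * of_real (sqrt pi)) = eta_coeff \<theta>"
    by (simp_all add: xi_coeff_def eta_coeff_def complex_eq_iff field_simps)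
  then show "xi_fn \<theta> z = xi_coeff \<theta> * (z + 1)" "eta_fn \<theta> z = eta_coeff \<theta> * (z + 1)"
    unfolding xi_fn_def eta_fn_def by (metis times_divide_eq_left mult.commute)+
qed

lemma closed_form_eq:
  assumes "norm (z + 1) < 1/4"
  shows "closed_form \<theta> z = (z + 1) powr of_real (lead_exp \<theta>) * regular_factor \<theta> (z + 1)"
proof -
  have phi: "phi_fn \<theta> z = quad \<theta> (z + 1) powr of_real (quad_exp \<theta>)"
    by (simp add: phi_fn_def quad_def quad_exp_def)
  show ?thesis
    unfolding closed_form_def delta_over_psi[OF assms] xi_eta_scaling phi regular_factor_def
    by (simp add: outer_const_def lead_exp_def binom_exp_def mult.assoc)
qed

end

text \<open>Both sides equal \<open>(z + 1)^a B(z + 1)\<close> for \<open>|z + 1| < 1/4\<close>.\<close>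
theorem mainTheorem1:
  fixes \<theta> :: real
  assumes "0 < \<theta>" and "\<theta> < pi"
  shows "\<exists>r>0. \<forall>z::complex. norm z < 1 \<and> norm (z + 1) < r \<longrightarrow>
    f_int \<theta> z =
      (z + 1) powr (of_real (1 - \<theta> / pi)) *
      ( - phi_fn \<theta> z / z
        + of_real (2 powr (\<theta> / pi) * pi powr ((pi + \<theta>) / (2 * pi))
                   / (2 * pi\<^sup>2 + pi * \<theta> - \<theta>\<^sup>2))
          * (delta_fn \<theta> z / psi_fn \<theta> z)
          * ( - 2 * of_real (2 * pi - \<theta>)
                * appell_F1 (of_real (1 - \<theta> / pi)) (of_real ((pi - \<theta>) / (2 * pi)))
                    (of_real ((pi - \<theta>) / (2 * pi))) (of_real (2 - \<theta> / pi))
                    (xi_fn \<theta> z) (eta_fn \<theta> z)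
              + of_real (pi + \<theta>) * (z + 1)
                * appell_F1 (of_real (2 - \<theta> / pi)) (of_real ((pi - \<theta>) / (2 * pi)))
                    (of_real ((pi - \<theta>) / (2 * pi))) (of_real (3 - \<theta> / pi))
                    (eta_fn \<theta> z) (xi_fn \<theta> z)))"
proof -
  interpret opening_angle \<theta> by unfold_locales (use assms in auto)
  have "f_int \<theta> z = closed_form \<theta> z" if "norm (z + 1) < 1/4" for z
    unfolding f_int_eq[OF that] closed_form_eq[OF that] ..
  then show ?thesis unfolding closed_form_def[symmetric] by (intro exI[of _ "1/4"]) auto
qed

end
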